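(* Let $p,q$ be integers with $p\ge3$ and $q>\frac{2p}{p-2}$. (1) The optimal cylinder packing density $\delta_p^{opt}(q)$ in $\widetilde{\mathbf{SL}_2\mathbf{R}}$ space is equal to the densest hyperbolic circle packing density related to the regular mosaic with Schl\"afli symbol $\{p,q\}$, i.e. $$\delta_p^{opt}(q)=\frac{\mathrm{Area}(C(r^h(p,q)))}{\mathrm{Area}(M_p^q)}.$$ (2) The optimal cylinder covering density $\Delta_p^{opt}(q)$ in $\widetilde{\mathbf{SL}_2\mathbf{R}}$ space is equal to the thinnest hyperbolic circle covering density related to the regular mosaic with Schl\"afli symbol $\{p,q\}$, i.e. $$\Delta_p^{opt}(q)=\frac{\mathrm{Area}(C(R^h(p,q)))}{\mathrm{Area}(M_p^q)}.$$
   Context: Hyperbolic side: $M_p^q$ is a tile of the regular tessellation of the hyperbolic plane $\mathbf{H}^2$ (curvature $-1$) with Schl\"afli symbol $\{p,q\}$. $C(r^h(p,q))$ and $C(R^h(p,q))$ are its inscribed and circumscribed discs, with radii $r^h(p,q)=\mathrm{arccosh}\Bigl(\frac{\cos(\pi/q)}{\sin(\pi/p)}\Bigr)$, $R^h(p,q)=\mathrm{arccosh}\bigl(\cot\frac\pi p\cot\frac\pi q\bigr)$, and $\mathrm{Area}(M_p^q)=2p\bigl(\frac\pi2-\frac\pi p-\frac\pi q\bigr)$. The densest circle packing (thinnest circle covering) related to the mosaic is the one by the inscribed (circumscribed) circles of its tiles, and its density is the ratio of the area of the inscribed (circumscribed) disc to the area of a tile. $\widetilde{\mathbf{SL}_2\mathbf{R}}$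 side: the metric in hyperboloid coordinates $(r,\theta,\phi)$ is $(\mathrm{d}s)^2=(\mathrm{d}r)^2+\cosh^2r\sinh^2r(\mathrm{d}\theta)^2+[\mathrm{d}\phi+\sinh^2r\,\mathrm{d}\theta]^2$, with volume element $\frac12\sinh(2r)\,\mathrm{d}r\,\mathrm{d}\theta\,\mathrm{d}\phi$. The base plane is $\phi=0$; in the projective model it is the open unit disc with Euclidean coordinates $y=\tanh r\cos\theta$, $z=\tanh r\sin\theta$. The area of a region $D$ of the base plane is the volume of the solid of fibre height $1$ over it, i.e. $\mathrm{Area}(D)=\int_D\frac12\sinh(2r)\,\mathrm{d}r\,\mathrm{d}\theta$. $\mathcal{C}^b(r)$ denotes the disc of radius $r$ about the origin in the base plane. $\mathcal{P}(p,q)$ is the base figure of the infinite regular $p$-sided prism, centred at the origin, of the regular infinite prism tiling $\mathcal{T}^i_p(q)$ with $q$ prisms meeting at each side edge. Explicitly: its vertices $A_1,\dots,A_p$ form a regular Euclidean $p$-gon centred at the origin with circumradius $b=\sqrt{\frac{1-\tan\frac\pi p\tan\frac\pi q}{1+\tan\frac\pi p\tan\frac\pi q}}$, and it is the region containing the origin bounded by the side curves $c_{A_iA_{i+1}}$ (indices mod $p$), each the minor circular arc from $A_i$ to $A_{i+1}$, curved towards the origin, of a Euclidean circle of radius $1/C_p(q)$, where $$C_p(q)=\sqrt{\frac{\cos\left(\frac{\pi}{p}+\frac{\pi}{q}\right)\left(\sin\frac{2\pi}{p}+\sin\frac{2\pi}{q}\right)}{\sin\left(\frac{\pi}{p}+\frac{\pi}{q}\right)\left(1-\cos\frac{2\pi}{p}\right)}}.$$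 $r_{opt}(p,q)$ is the radius (in the $\widetilde{\mathbf{SL}_2\mathbf{R}}$ sense) of the inscribed circle of $\mathcal{P}(p,q)$, i.e. the circle about the origin touching all side curves; $R_{opt}(p,q)=\mathrm{arctanh}(b)$ is the radius of its circumscribed circle, i.e. the circle about the origin through the vertices. The density of the optimal cylinder packing, respectively covering, related to $\mathcal{T}^i_p(q)$ (by the fibre-like infinite circular cylinders inscribed in, respectively circumscribed about, the prisms) is defined by $$\delta_p^{opt}(q)=\frac{\mathrm{Area}(\mathcal{C}^b(r_{opt}(p,q)))}{\mathrm{Area}(\mathcal{P}(p,q))},\qquad \Delta_p^{opt}(q)=\frac{\mathrm{Area}(\mathcal{C}^b(R_{opt}(p,q)))}{\mathrm{Area}(\mathcal{P}(p,q))}.$$ *)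

theory Defs
  imports "HOL-Analysis.Analysis"
begin

text \<open>
  Points of the base plane of the universal cover of \<open>SL\<^sub>2(R)\<close>, and points of the hyperbolic
  plane of curvature \<open>-1\<close>, are both represented by complex numbers in the open unit disc, in
  polar coordinates \<open>rcis (tanh r) \<theta>\<close>. On the first side this is the projective model,
  \<open>y + iz\<close> with \<open>y = tanh r cos \<theta>\<close> and \<open>z = tanh r sin \<theta>\<close>; on the second
  side it is the Beltrami-Klein model in geodesic polar coordinates, with metric
  \<open>dr\<^sup>2 + sinh\<^sup>2 r d\<theta>\<^sup>2\<close>. In both geometries \<open>r\<close> is the distance
  from the origin: the metric is at least \<open>dr\<^sup>2\<close>, with equality along radial lines. Hence
  discs and circles about the origin are the same subsets of the unit disc in the two models; the
  area elements are different.
\<close>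

definition polar_point :: "real \<Rightarrow> real \<Rightarrow> complex" where
  "polar_point r \<theta> = rcis (tanh r) \<theta>"

definition polar_circle :: "real \<Rightarrow> complex set" where
  "polar_circle r = {polar_point r \<theta> | \<theta>. True}"

definition polar_disc :: "real \<Rightarrow> complex set" where
  "polar_disc r = {polar_point s \<theta> | s \<theta>. 0 \<le> s \<and> s \<le> r}"

definition polar_region :: "complex set \<Rightarrow> (real \<times> real) set" where
  "polar_region D = {(r, \<theta>). 0 \<le> r \<and> 0 \<le> \<theta> \<and> \<theta> < 2 * pi \<and> polar_point r \<theta> \<in> D}"

text \<open>
  The volume element \<open>1/2 sinh (2r) dr d\<theta> d\<phi>\<close> integrated over the solid of fibre height
  \<open>1\<close> above \<open>D\<close> (that is, \<open>0 \<le> \<phi> \<le> 1\<close>).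
\<close>

definition sl_area :: "complex set \<Rightarrow> real" where
  "sl_area D = (LINT x:polar_region D|lborel. sinh (2 * fst x) / 2)"

definition hyp_area :: "complex set \<Rightarrow> real" where
  "hyp_area D = (LINT x:polar_region D|lborel. sinh (fst x))"


section \<open>The hyperbolic mosaic with Schlaefli symbol {p,q}\<close>

definition hyp_inradius :: "nat \<Rightarrow> nat \<Rightarrow> real" where
  "hyp_inradius p q = arcosh (cos (pi / q) / sin (pi / p))"

definition hyp_circumradius :: "nat \<Rightarrow> nat \<Rightarrow> real" where
  "hyp_circumradius p q = arcosh (cot (pi / p) * cot (pi / q))"

text \<open>
  A tile is a regular hyperbolic \<open>p\<close>-gon whose size is determined by its interior angles
  \<open>2\<pi>/q\<close>, equivalently by the above circumradius. Geodesics of the Klein model are chords,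
  so hyperbolic and Euclidean convex hulls agree.
\<close>

definition hyp_tile :: "nat \<Rightarrow> nat \<Rightarrow> complex set" where
  "hyp_tile p q =
     convex hull ((\<lambda>k. polar_point (hyp_circumradius p q) (2 * pi * real k / real p)) ` {..<p})"


section \<open>The base figure of the regular infinite prism\<close>

definition base_circumradius :: "nat \<Rightarrow> nat \<Rightarrow> real" where
  "base_circumradius p q =
     sqrt ((1 - tan (pi / p) * tan (pi / q)) / (1 + tan (pi / p) * tan (pi / q)))"

text \<open>Indices are modulo \<open>p\<close>, since \<open>k\<close> and \<open>k + p\<close> give the same vertex.\<close>

definition base_vertex :: "nat \<Rightarrow> nat \<Rightarrow> nat \<Rightarrow> complex" where
  "base_vertex p q k = rcis (base_circumradius p q) (2 * pi * real k / real p)"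

definition side_curvature :: "nat \<Rightarrow> nat \<Rightarrow> real" where
  "side_curvature p q =
     sqrt (cos (pi / p + pi / q) * (sin (2 * pi / p) + sin (2 * pi / q)) /
       (sin (pi / p + pi / q) * (1 - cos (2 * pi / p))))"

text \<open>
  Two circles of radius \<open>1 / C\<close> pass through two neighbouring vertices. The minor arc of
  one of them is curved towards the origin iff its centre lies beyond the chord as seen from the
  origin, i.e. at distance \<open>sqrt (1 / C\<^sup>2 - (half chord)\<^sup>2)\<close> from the midpoint of the
  chord in the outward direction.
\<close>

definition side_midpoint :: "nat \<Rightarrow> nat \<Rightarrow> nat \<Rightarrow> complex" where
  "side_midpoint p q k = midpoint (base_vertex p q k) (base_vertex p q (k + 1))"

definition side_centre :: "nat \<Rightarrow> nat \<Rightarrow> nat \<Rightarrow> complex" where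
  "side_centre p q k =
     side_midpoint p q k +
       sqrt ((1 / side_curvature p q)\<^sup>2 - (dist (base_vertex p q k) (base_vertex p q (k + 1)) / 2)\<^sup>2)
         *\<^sub>R sgn (side_midpoint p q k)"

text \<open>
  The minor arc is the part of the circle separated from the centre by the chord; the second
  condition selects the closed half-plane of the chord that contains the origin.
\<close>

definition side_curve :: "nat \<Rightarrow> nat \<Rightarrow> nat \<Rightarrow> complex set" where
  "side_curve p q k =
     {z. dist z (side_centre p q k) = 1 / side_curvature p q \<and>
         (z - side_midpoint p q k) \<bullet> side_midpoint p q k \<le> 0}"

definition base_boundary :: "nat \<Rightarrow> nat \<Rightarrow> complex set" where
  "base_boundary p q = (\<Union>k<p. side_curve p q k)"

definition base_figure :: "nat \<Rightarrow> nat \<Rightarrow> complex set" where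
  "base_figure p q = connected_component_set (- base_boundary p q) 0 \<union> base_boundary p q"

text \<open>The inscribed circle lies in the figure and has exactly one point of contact with each side.\<close>

definition inscribed_radius :: "nat \<Rightarrow> nat \<Rightarrow> real \<Rightarrow> bool" where
  "inscribed_radius p q r \<longleftrightarrow>
     0 < r \<and> polar_disc r \<subseteq> base_figure p q \<and>
     (\<forall>k<p. \<exists>!z. z \<in> polar_circle r \<inter> side_curve p q k)"

definition r_opt :: "nat \<Rightarrow> nat \<Rightarrow> real" where
  "r_opt p q = (THE r. inscribed_radius p q r)"

definition R_opt :: "nat \<Rightarrow> nat \<Rightarrow> real" where
  "R_opt p q = artanh (base_circumradius p q)"

definition packing_density_opt :: "nat \<Rightarrow> nat \<Rightarrow> real" where
  "packing_density_opt p q = sl_area (polar_disc (r_opt p q)) / sl_area (base_figure p q)"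

definition covering_density_opt :: "nat \<Rightarrow> nat \<Rightarrow> real" where
  "covering_density_opt p q = sl_area (polar_disc (R_opt p q)) / sl_area (base_figure p q)"

end

theory Submission
  imports Defs
begin

text \<open>
  Doubling the radius, \<open>(r, \<theta>) \<mapsto> (2r, \<theta>)\<close>, identifies the base plane with
  the hyperbolic plane and multiplies areas by four. In the two disc models
  it is the passage \<open>z \<mapsto> 2z / (1 + |z|\<^sup>2)\<close> from the Poincare to the Beltrami-Klein model. The
  circles carrying the sides of the base figure turn out to be orthogonal to the unit circle, so
  they become the chords carrying the sides of the tile, and the base figure becomes the tile.
  Likewise \<open>r_opt\<close> and \<open>R_opt\<close> are half of the hyperbolic inradius and circumradius, so
  numerator and denominator of each density change by the same factor and no area is computed.
\<close>

section \<open>Regular polygons in the complex plane\<close>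

text \<open>The outward unit normal of the edge from vertex \<open>k\<close> to vertex
  \<open>k + 1\<close>, its angle being halfway between theirs. The centre of the
  \<open>k\<close>-th side circle lies on the same ray, so tile and base figure are described by the
  same inner products.\<close>

definition edge_normal :: "nat \<Rightarrow> nat \<Rightarrow> complex" where
  "edge_normal p k = cis ((2 * real k + 1) * pi / real p)"

lemma norm_edge_normal [simp]: "norm (edge_normal p k) = 1"
  by (simp add: edge_normal_def)

lemma inner_edge_normal_self [simp]: "edge_normal p k \<bullet> edge_normal p k = 1"
  by (simp add: norm_eq_1[symmetric])

lemma inner_rcis_edge_normal:
  "rcis s ((2 * real k + 1) * pi / real p + \<delta>) \<bullet> edge_normal p k = s * cos \<delta>"
proof -
  define x where "x = (2 * real k + 1) * pi / real p"
  have "rcis s (x + \<delta>) \<bullet> cis x = s * cos ((x + \<delta>) - x)"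
    unfolding cos_diff by (simp add: inner_complex_def algebra_simps)
  then show ?thesis by (simp add: x_def edge_normal_def)
qed

text \<open>The \<open>p\<close> sectors of half-angle \<open>pi / p\<close> about the edge normals
  cover the plane.\<close>

lemma rcis_sector:
  assumes "p > 0"
  obtains k \<delta> where "k < p" "\<bar>\<delta>\<bar> \<le> pi / real p"
    "z = rcis (norm z) ((2 * real k + 1) * pi / real p + \<delta>)"
proof -
  \<comment> \<open>The argument in units of \<open>2 * pi / p\<close>: its floor, reduced modulo
    \<open>p\<close>, numbers the sector, and the fractional part gives the deviation
    \<open>\<delta>\<close> from the axis.\<close>
  define x where "x = Arg z * real p / (2 * pi)"
  define m where "m = \<lfloor>x\<rfloor>"
  define k where "k = nat (m mod int p)"
  define \<delta> where "\<delta> = (2 * (x - m) - 1) * pi / real p"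
  have k: "k < p" using assms by (simp add: k_def nat_less_iff)
  have "0 \<le> x - m" "x - m \<le> 1" unfolding m_def by linarith+
  then have "\<bar>2 * (x - m) - 1\<bar> * pi \<le> 1 * pi" by (intro mult_right_mono) auto
  then have \<delta>: "\<bar>\<delta>\<bar> \<le> pi / real p"
    using assms by (simp add: \<delta>_def abs_mult divide_right_mono)
  have "m = int k + int p * (m div int p)" using assms by (simp add: k_def)
  then have m: "real_of_int m = real k + real p * real_of_int (m div int p)"
    by (metis of_int_add of_int_mult of_int_of_nat_eq)
  have "Arg z = (2 * real_of_int m + 1) * pi / real p + \<delta>"
    using assms by (simp add: \<delta>_def x_def field_simps)
  moreover have "(2 * real_of_int m + 1) * pi / real p = (2 * real k + 1) * pi / real p + 2 * pi * real_of_int (m div int p)"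
    using assms unfolding m by (simp add: field_simps)
  ultimately have "Arg z = ((2 * real k + 1) * pi / real p + \<delta>) + 2 * pi * real_of_int (m div int p)"
    by simp
  then have "cis (Arg z) = cis ((2 * real k + 1) * pi / real p + \<delta>)"
    by (simp add: cis_mult[symmetric])
  then have "z = rcis (norm z) ((2 * real k + 1) * pi / real p + \<delta>)"
    by (metis rcis_cmod_Arg rcis_def)
  then show thesis using that k \<delta> by blast
qed

text \<open>Some normal is within angle \<open>pi / p\<close> of \<open>z\<close>. This later turns
  the side conditions into a bound on the norm.\<close>

lemma exists_edge_normal_inner_ge:
  assumes "p > 0"
  obtains k where "k < p" "norm z * cos (pi / real p) \<le> z \<bullet> edge_normal p k"
proof -
  obtain k \<delta> where k: "k < p" "\<bar>\<delta>\<bar> \<le> pi / real p"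
    and z: "z = rcis (norm z) ((2 * real k + 1) * pi / real p + \<delta>)"
    using rcis_sector[OF assms] by blast
  have "pi / real p \<le> pi" using assms by (simp add: divide_le_eq)
  with k have "cos (pi / real p) \<le> cos \<bar>\<delta>\<bar>" by (intro cos_monotone_0_pi_le) auto
  then have "norm z * cos (pi / real p) \<le> norm z * cos \<delta>" by (simp add: mult_left_mono)
  also have "\<dots> = z \<bullet> edge_normal p k" using z inner_rcis_edge_normal by metis
  finally show thesis using k that by blast
qed

text \<open>The angle between a vertex and an edge normal is an odd multiple of
  \<open>pi / p\<close>, so this says that no vertex lies beyond an edge line.\<close>

lemma cos_odd_multiple_le:
  fixes m :: int
  assumes "p > 0"
  shows "cos ((2 * real_of_int m + 1) * pi / real p) \<le> cos (pi / real p)"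
proof -
  define k where "k = m mod int p"
  define x where "x = (2 * real_of_int k + 1) * pi / real p"
  have k: "0 \<le> k" "k < int p" using assms by (simp_all add: k_def)
  have m: "real_of_int m = real_of_int k + real p * real_of_int (m div int p)"
    unfolding k_def by (metis mod_mult_div_eq of_int_add of_int_mult of_int_of_nat_eq)
  have "(2 * real_of_int m + 1) * pi / real p = x + 2 * pi * real_of_int (m div int p)"
    using assms unfolding m x_def by (simp add: field_simps)
  then have eq: "cos ((2 * real_of_int m + 1) * pi / real p) = cos x"
    by (simp add: cos_add)
  have "1 * pi / real p \<le> x"
    unfolding x_def using k by (intro divide_right_mono mult_right_mono) auto
  moreover have "x \<le> (2 * real p - 1) * pi / real p"
    unfolding x_def using k by (intro divide_right_mono mult_right_mono) auto
  then have "x \<le> 2 * pi - pi / real p" using assms by (simp add: field_simps)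
  moreover have "pi / real p > 0" using assms by simp
  \<comment> \<open>Reflecting \<open>x\<close> to \<open>2 * pi - x\<close> where necessary brings
    the angle into \<open>[0, pi]\<close>, where cosine decreases.\<close>
  ultimately have "cos (if x \<le> pi then x else 2 * pi - x) \<le> cos (pi / real p)"
    by (intro cos_monotone_0_pi_le) auto
  then have "cos x \<le> cos (pi / real p)" by (simp add: cos_diff split: if_splits)
  then show ?thesis using eq by simp
qed

section \<open>The regular polygon as an intersection of half-planes\<close>

abbreviation regular_vertices :: "nat \<Rightarrow> real \<Rightarrow> complex set" where
  "regular_vertices p B \<equiv> (\<lambda>k. rcis B (2 * pi * real k / real p)) ` {..<p}"

text \<open>The edge with \<open>k = p - 1\<close> ends at index \<open>p\<close>, outside the range
  of the hull; periodicity brings it back.\<close>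

lemma regular_vertex_in_hull:
  assumes "p > 0"
  shows "rcis B (2 * pi * real k / real p) \<in> convex hull regular_vertices p B"
proof -
  have k: "real k = real (k mod p) + real p * real (k div p)"
    by (metis mod_mult_div_eq of_nat_add of_nat_mult)
  have "2 * pi * real k / real p = 2 * pi * real (k mod p) / real p + 2 * pi * real (k div p)"
    using assms by (subst k) (simp add: field_simps)
  then have "rcis B (2 * pi * real k / real p) = rcis B (2 * pi * real (k mod p) / real p)"
    by (simp add: rcis_def cis_mult[symmetric] cis_multiple_2pi)
  also have "\<dots> \<in> regular_vertices p B" using assms by simp
  finally show ?thesis by (rule hull_inc)
qed

text \<open>The origin is the centroid of the vertices because the \<open>p\<close>-th roots of
  unity sum to zero.\<close>

lemma zero_in_regular_hull:
  assumes "p > 1"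
  shows "0 \<in> convex hull regular_vertices p B"
proof -
  have "(\<Sum>k<p. cis (2 * pi * real k / real p)) = 0"
  proof -
    have "(\<Sum>k<p. cis (2 * pi * real k / real p)) = \<Sum> {z::complex. z ^ p = 1}"
      using sum.reindex_bij_betw[OF Complex.bij_betw_roots_unity[of p], of "\<lambda>z. z"] assms by simp
    also have "\<dots> = 0" using assms by (rule sum_roots_unity)
    finally show ?thesis .
  qed
  then have "(\<Sum>k<p. (1 / real p) *\<^sub>R rcis B (2 * pi * real k / real p)) = 0"
    by (simp add: rcis_def scaleR_sum_right[symmetric] sum_distrib_left[symmetric])
  moreover have "(\<Sum>k<p. (1 / real p) *\<^sub>R rcis B (2 * pi * real k / real p))
      \<in> convex hull regular_vertices p B"
    using assms by (intro convex_sum) (auto intro: hull_inc)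
  ultimately show ?thesis by simp
qed

lemma adjacent_vertices:
  fixes p k
  defines "\<psi> \<equiv> (2 * real k + 1) * pi / real p"
  shows "2 * pi * real k / real p = \<psi> - pi / real p"
    and "2 * pi * real (k + 1) / real p = \<psi> + pi / real p"
  by (simp_all add: \<psi>_def diff_divide_distrib[symmetric] add_divide_distrib[symmetric] algebra_simps)

text \<open>An edge line meets the closed disc of radius \<open>B\<close> exactly in the edge. This
  allows membership in the polygon to be proved from one equation and a norm bound.\<close>

lemma edge_in_regular_hull:
  assumes p: "p > 1" and B: "B > 0"
    and w: "w \<bullet> edge_normal p k = B * cos (pi / real p)" "norm w \<le> B"
  shows "w \<in> convex hull regular_vertices p B"
proof -
  define \<alpha> \<psi> where "\<alpha> = pi / real p" and "\<psi> = (2 * real k + 1) * pi / real p"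
  \<comment> \<open>Rotation turns the edge normal into the positive real axis, so the edge becomes
    vertical.\<close>
  define v where "v = w * cnj (cis \<psi>)"
  have w_eq: "w = v * cis \<psi>" by (simp add: v_def cis_cnj mult.assoc cis_mult)
  have "0 < \<alpha>" "\<alpha> < pi" using p by (simp_all add: \<alpha>_def field_simps)
  then have s: "sin \<alpha> > 0" by (rule sin_gt_zero)
  have Re: "Re v = B * cos \<alpha>"
    using w(1) by (simp add: v_def \<alpha>_def \<psi>_def edge_normal_def inner_complex_def)
  have "(cmod v)\<^sup>2 \<le> B\<^sup>2" using w(2) B by (simp add: v_def norm_mult power_mono)
  then have "(Im v)\<^sup>2 \<le> B\<^sup>2 * (1 - (cos \<alpha>)\<^sup>2)"
    unfolding cmod_power2 Re by (simp add: power_mult_distrib algebra_simps)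
  then have "(Im v)\<^sup>2 \<le> (B * sin \<alpha>)\<^sup>2"
    unfolding sin_squared_eq[symmetric] by (simp add: power_mult_distrib)
  then have Im: "\<bar>Im v\<bar> \<le> B * sin \<alpha>"
    using s B by (metis abs_le_square_iff abs_of_pos mult_pos_pos)
  \<comment> \<open>Position along the edge relative to its midpoint, in units of half its length;
    the endpoints are \<open>t = -1\<close> and \<open>t = 1\<close>.\<close>
  define t where "t = Im v / (B * sin \<alpha>)"
  have t: "\<bar>t\<bar> \<le> 1" using Im s B by (simp add: t_def abs_mult divide_le_eq)
  have Imt: "Im v = t * (B * sin \<alpha>)" using s B by (simp add: t_def)
  have "v = ((1 - t) / 2) *\<^sub>R rcis B (- \<alpha>) + ((1 + t) / 2) *\<^sub>R rcis B \<alpha>"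
    unfolding complex_eq_iff using Re Imt by (simp add: field_simps)
  then have "w = ((1 - t) / 2) *\<^sub>R (rcis B (- \<alpha>) * cis \<psi>) + ((1 + t) / 2) *\<^sub>R (rcis B \<alpha> * cis \<psi>)"
    unfolding w_eq by (simp add: distrib_right)
  also have "rcis B (- \<alpha>) * cis \<psi> = rcis B (2 * pi * real k / real p)"
    using adjacent_vertices(1)[of k p] by (simp add: rcis_def cis_mult \<alpha>_def \<psi>_def)
  also have "rcis B \<alpha> * cis \<psi> = rcis B (2 * pi * real (k + 1) / real p)"
    using adjacent_vertices(2)[of k p] by (simp add: rcis_def cis_mult \<alpha>_def \<psi>_def add_ac)
  also have "((1 - t) / 2) *\<^sub>R rcis B (2 * pi * real k / real p)
      + ((1 + t) / 2) *\<^sub>R rcis B (2 * pi * real (k + 1) / real p)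
      \<in> convex hull regular_vertices p B"
    using p t by (intro convexD regular_vertex_in_hull) (auto simp: field_simps)
  finally show ?thesis .
qed

text \<open>One inclusion only needs the vertices to be checked, by
  \<open>cos_odd_multiple_le\<close>. For the other, a point is placed in the triangle spanned by
  the origin and the edge of its sector.\<close>

lemma regular_hull_eq:
  assumes p: "p \<ge> 3" and B: "B > 0"
  shows "convex hull regular_vertices p B =
    {w. \<forall>k<p. w \<bullet> edge_normal p k \<le> B * cos (pi / real p)}" (is "_ = ?P")
proof
  have "convex ?P"
  proof -
    have "?P = (\<Inter>k\<in>{..<p}. {w. edge_normal p k \<bullet> w \<le> B * cos (pi / real p)})"
      by (auto simp: inner_commute)
    then show ?thesis by (auto intro!: convex_INT convex_halfspace_le)
  qed
  moreover have "regular_vertices p B \<subseteq> ?P"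
  proof clarsimp
    fix j k
    define m where "m = int j - int k - 1"
    have "2 * pi * real j / real p = (2 * real k + 1) * pi / real p + (2 * real_of_int m + 1) * pi / real p"
      by (simp add: m_def add_divide_distrib[symmetric] algebra_simps)
    then have "rcis B (2 * pi * real j / real p) \<bullet> edge_normal p k
        = B * cos ((2 * real_of_int m + 1) * pi / real p)"
      by (simp only: inner_rcis_edge_normal)
    also have "\<dots> \<le> B * cos (pi / real p)"
      using cos_odd_multiple_le[of p m] p B by (intro mult_left_mono) auto
    finally show "rcis B (2 * pi * real j / real p) \<bullet> edge_normal p k \<le> B * cos (pi / real p)" .
  qed
  ultimately show "convex hull regular_vertices p B \<subseteq> ?P" by (rule hull_minimal[rotated])
next
  show "?P \<subseteq> convex hull regular_vertices p B"
  proof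
    fix w assume w: "w \<in> ?P"
    define \<alpha> where "\<alpha> = pi / real p"
    have "p > 0" using p by simp
    obtain k \<delta> where k: "k < p" "\<bar>\<delta>\<bar> \<le> pi / real p"
      and w_eq: "w = rcis (norm w) ((2 * real k + 1) * pi / real p + \<delta>)"
      using rcis_sector[OF \<open>p > 0\<close>] by blast
    define s \<psi> where "s = norm w" and "\<psi> = (2 * real k + 1) * pi / real p"
    have \<alpha>: "0 < \<alpha>" "2 * \<alpha> < pi" using p by (auto simp: \<alpha>_def field_simps)
    then have pos: "sin \<alpha> > 0" "cos \<alpha> > 0" "sin (2 * \<alpha>) > 0"
      by (auto intro!: sin_gt_zero cos_gt_zero)
    \<comment> \<open>Barycentric coordinates with respect to the two vertices of the edge, by
      Cramer's rule; the origin gets the weight \<open>1 - (x + y)\<close>. The edge inequality is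
      exactly \<open>x + y \<le> 1\<close>.\<close>
    define x y where "x = s * sin (\<alpha> - \<delta>) / (B * sin (2 * \<alpha>))"
      and "y = s * sin (\<alpha> + \<delta>) / (B * sin (2 * \<alpha>))"
    have "\<bar>\<delta>\<bar> \<le> \<alpha>" using k by (simp add: \<alpha>_def)
    then have "sin (\<alpha> - \<delta>) \<ge> 0" "sin (\<alpha> + \<delta>) \<ge> 0" using \<alpha> by (auto intro!: sin_ge_zero)
    then have xy: "x \<ge> 0" "y \<ge> 0" using pos B by (simp_all add: x_def y_def s_def)
    have "x + y = s * (2 * sin \<alpha> * cos \<delta>) / (B * sin (2 * \<alpha>))"
      by (simp add: x_def y_def sin_add sin_diff add_divide_distrib[symmetric] algebra_simps)
    also have "\<dots> = s * cos \<delta> / (B * cos \<alpha>)"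
      using pos B by (simp add: sin_double)
    also have "s * cos \<delta> = w \<bullet> edge_normal p k"
      using w_eq inner_rcis_edge_normal unfolding s_def by metis
    also have "\<dots> / (B * cos \<alpha>) \<le> 1"
      using w k B pos by (simp add: \<alpha>_def divide_le_eq)
    finally have xy1: "x + y \<le> 1" .
    have "x *\<^sub>R rcis B (- \<alpha>) + y *\<^sub>R rcis B \<alpha> = rcis s \<delta>"
    proof -
      have xB: "x * B = s * sin (\<alpha> - \<delta>) / sin (2 * \<alpha>)" "y * B = s * sin (\<alpha> + \<delta>) / sin (2 * \<alpha>)"
        using B by (simp_all add: x_def y_def)
      have "(x * B + y * B) * cos \<alpha> = s * (2 * sin \<alpha> * cos \<delta>) / sin (2 * \<alpha>) * cos \<alpha>"
        unfolding xB by (simp add: sin_add sin_diff add_divide_distrib[symmetric] algebra_simps)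
      also have "\<dots> = s * cos \<delta>" using pos by (simp add: sin_double)
      finally have re: "(x * B + y * B) * cos \<alpha> = s * cos \<delta>" .
      have "(y * B - x * B) * sin \<alpha> = s * (2 * cos \<alpha> * sin \<delta>) / sin (2 * \<alpha>) * sin \<alpha>"
        unfolding xB by (simp add: sin_add sin_diff diff_divide_distrib[symmetric] algebra_simps)
      also have "\<dots> = s * sin \<delta>" using pos by (simp add: sin_double)
      finally have im: "(y * B - x * B) * sin \<alpha> = s * sin \<delta>" .
      show ?thesis using re im by (simp add: complex_eq_iff algebra_simps)
    qed
    then have "w = (x *\<^sub>R rcis B (- \<alpha>) + y *\<^sub>R rcis B \<alpha>) * cis \<psi>"
      using w_eq by (simp add: s_def \<psi>_def rcis_def cis_mult add.commute mult.assoc)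
    also have "\<dots> = x *\<^sub>R (rcis B (- \<alpha>) * cis \<psi>) + y *\<^sub>R (rcis B \<alpha> * cis \<psi>)"
      by (simp add: distrib_right)
    also have "rcis B (- \<alpha>) * cis \<psi> = rcis B (2 * pi * real k / real p)"
      using adjacent_vertices(1)[of k p] by (simp add: rcis_def cis_mult \<alpha>_def \<psi>_def)
    also have "rcis B \<alpha> * cis \<psi> = rcis B (2 * pi * real (k + 1) / real p)"
      using adjacent_vertices(2)[of k p] by (simp add: rcis_def cis_mult \<alpha>_def \<psi>_def add_ac)
    finally have w_comb: "w = (1 - (x + y)) *\<^sub>R 0 + x *\<^sub>R rcis B (2 * pi * real k / real p)
        + y *\<^sub>R rcis B (2 * pi * real (k + 1) / real p)"
      by simp
    have "0 \<in> convex hull regular_vertices p B" using p by (intro zero_in_regular_hull) simp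
    moreover have "rcis B (2 * pi * real k / real p) \<in> convex hull regular_vertices p B"
      "rcis B (2 * pi * real (k + 1) / real p) \<in> convex hull regular_vertices p B"
      using p by (intro regular_vertex_in_hull; simp)+
    ultimately have "{0, rcis B (2 * pi * real k / real p), rcis B (2 * pi * real (k + 1) / real p)}
        \<subseteq> convex hull regular_vertices p B" by blast
    then have "convex hull {0, rcis B (2 * pi * real k / real p), rcis B (2 * pi * real (k + 1) / real p)}
        \<subseteq> convex hull regular_vertices p B" by (rule hull_minimal) simp
    moreover have "w \<in> convex hull {0, rcis B (2 * pi * real k / real p), rcis B (2 * pi * real (k + 1) / real p)}"
      unfolding convex_hull_3 mem_Collect_eq
      using xy xy1 w_comb by (intro exI[of _ "1 - (x + y)"] exI[of _ x] exI[of _ y]) simp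
    ultimately show "w \<in> convex hull regular_vertices p B" by blast
  qed
qed

section \<open>Polar regions and their areas\<close>

lemma polar_region_measurable:
  assumes "closed D"
  shows "polar_region D \<in> sets borel"
proof -
  have "continuous_on UNIV (\<lambda>x::real \<times> real. polar_point (fst x) (snd x))"
    unfolding polar_point_def rcis_def tanh_def by (intro continuous_intros) auto
  then have "closed ((\<lambda>x::real \<times> real. polar_point (fst x) (snd x)) -` D)"
    using assms by (simp add: closed_vimage continuous_on_eq_continuous_within)
  moreover have "polar_region D =
      {0..} \<times> {0..<2 * pi} \<inter> (\<lambda>x. polar_point (fst x) (snd x)) -` D"
    by (auto simp: polar_region_def)
  moreover have "{0..} \<times> {0..<2 * pi} \<in> sets (borel :: (real \<times> real) measure)"
    unfolding borel_prod[symmetric] by (intro pair_measureI) auto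
  ultimately show ?thesis by (simp add: sets.Int)
qed

text \<open>Linear change of variables for the diagonal map with factors \<open>c\<close> and
  \<open>1\<close>, whose Jacobian is \<open>c\<close>.\<close>

lemma integral_scale_fst:
  fixes g :: "real \<times> real \<Rightarrow> real"
  assumes c: "c > 0" and [measurable]: "g \<in> borel_measurable borel"
  shows "(LINT x|lborel. g (c * fst x, snd x)) = (LINT x|lborel. g x) / c"
proof -
  define T :: "real \<times> real \<Rightarrow> real \<times> real" where "T = (\<lambda>x. (c * fst x, snd x))"
  define f :: "real \<times> real \<Rightarrow> real" where "f = (\<lambda>j. if j = (1, 0) then c else 1)"
  have B: "Basis = {(1::real, 0::real), (0, 1)}" by (auto simp: Basis_prod_def)
  have [measurable]: "T \<in> borel_measurable borel"
    unfolding T_def by (intro borel_measurable_continuous_onI continuous_intros)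
  have "T = (\<lambda>x. 0 + (\<Sum>j\<in>Basis. (f j * (x \<bullet> j)) *\<^sub>R j))"
    by (auto simp: T_def f_def B fun_eq_iff)
  moreover have "lborel = density (distr lborel borel (\<lambda>x. 0 + (\<Sum>j\<in>Basis. (f j * (x \<bullet> j)) *\<^sub>R j)))
      (\<lambda>_. ennreal (\<Prod>j\<in>Basis. \<bar>f j\<bar>))"
    using c by (intro lborel_affine_euclidean) (simp add: f_def)
  ultimately have "lborel = density (distr lborel borel T) (\<lambda>_. ennreal c)"
    using c by (simp add: f_def B)
  then have "(LINT x|lborel. g x) = (LINT x|density (distr lborel borel T) (\<lambda>_. ennreal c). g x)"
    by simp
  also have "\<dots> = c * (LINT x|lborel. g (T x))"
    using c by (simp add: integral_density integral_distr)
  finally show ?thesis using c by (simp add: T_def)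
qed

text \<open>Substituting \<open>2 * r\<close> for the radius turns \<open>sinh (2 * r) / 2\<close>
  into the hyperbolic density: one factor 1/2 is in the integrand, the other comes from the
  Jacobian.\<close>

lemma sl_area_eq_hyp_area:
  assumes "closed E"
    and DE: "\<And>r \<theta>. r \<ge> 0 \<Longrightarrow> polar_point r \<theta> \<in> D \<longleftrightarrow> polar_point (2 * r) \<theta> \<in> E"
  shows "sl_area D = hyp_area E / 4"
proof -
  define g :: "real \<times> real \<Rightarrow> real" where "g = (\<lambda>x. indicator (polar_region E) x * sinh (fst x))"
  have [measurable]: "polar_region E \<in> sets borel" using assms by (intro polar_region_measurable)
  have [measurable]: "(\<lambda>x::real \<times> real. sinh (fst x)) \<in> borel_measurable borel"
    by (intro borel_measurable_continuous_onI continuous_intros)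
  have [measurable]: "g \<in> borel_measurable borel" unfolding g_def by measurable
  have "x \<in> polar_region D \<longleftrightarrow> (2 * fst x, snd x) \<in> polar_region E" for x
    using DE by (auto simp: polar_region_def)
  then have "sl_area D = (LINT x|lborel. g (2 * fst x, snd x) / 2)"
    unfolding sl_area_def set_lebesgue_integral_def g_def
    by (intro Bochner_Integration.integral_cong) (auto simp: indicator_def)
  also have "\<dots> = hyp_area E / 4"
    using integral_scale_fst[of 2 g] by (simp add: hyp_area_def set_lebesgue_integral_def g_def)
  finally show ?thesis .
qed

section \<open>Discs and circles about the origin\<close>

lemma polar_point_in_disc_iff:
  assumes "r \<ge> 0"
  shows "polar_point r \<theta> \<in> polar_disc R \<longleftrightarrow> r \<le> R"
proof
  assume "polar_point r \<theta> \<in> polar_disc R"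
  then obtain s \<phi> where s: "0 \<le> s" "s \<le> R" and "polar_point r \<theta> = polar_point s \<phi>"
    by (auto simp: polar_disc_def)
  then have "\<bar>tanh r\<bar> = \<bar>tanh s\<bar>" unfolding polar_point_def by (metis complex_mod_rcis)
  then show "r \<le> R" using s assms by simp
qed (use assms in \<open>auto simp: polar_disc_def\<close>)

lemma tanh_artanh_real:
  fixes x :: real
  assumes "\<bar>x\<bar> < 1"
  shows "tanh (artanh x) = x"
proof -
  have "exp (- 2 * artanh x) = (1 - x) / (1 + x)"
    using assms by (simp add: artanh_def exp_minus)
  then show ?thesis
    unfolding tanh_real_altdef \<open>exp _ = _\<close> using assms by (simp add: divide_simps)
qed

lemma polar_disc_eq_cball:
  assumes "r \<ge> 0"
  shows "polar_disc r = cball 0 (tanh r)"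
proof safe
  fix z assume "z \<in> polar_disc r"
  then show "z \<in> cball 0 (tanh r)" using assms by (auto simp: polar_disc_def polar_point_def)
next
  fix z :: complex assume z: "z \<in> cball 0 (tanh r)"
  then have "norm z < 1" using tanh_real_lt_1[of r] by simp
  then have "tanh (artanh (norm z)) = norm z" by (intro tanh_artanh_real) simp
  moreover from this have "artanh (norm z) \<ge> 0" "artanh (norm z) \<le> r"
    using z by (metis norm_ge_zero tanh_real_nonneg_iff, metis mem_cball_0 tanh_real_le_iff)
  ultimately show "z \<in> polar_disc r"
    unfolding polar_disc_def polar_point_def
    by (smt (verit) mem_Collect_eq rcis_cmod_Arg)
qed

lemma polar_circle_eq_sphere:
  assumes "r \<ge> 0"
  shows "polar_circle r = sphere 0 (tanh r)"
proof safe
  fix z assume "z \<in> polar_circle r"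
  then show "z \<in> sphere 0 (tanh r)" using assms by (auto simp: polar_circle_def polar_point_def)
next
  fix z :: complex assume z: "z \<in> sphere 0 (tanh r)"
  then show "z \<in> polar_circle r"
    unfolding polar_circle_def polar_point_def by (metis (mono_tags, lifting) mem_Collect_eq mem_sphere_0 rcis_cmod_Arg)
qed

lemma sl_area_disc:
  assumes "r \<ge> 0"
  shows "sl_area (polar_disc (r / 2)) = hyp_area (polar_disc r) / 4"
proof (rule sl_area_eq_hyp_area)
  show "closed (polar_disc r)" using assms by (simp add: polar_disc_eq_cball)
qed (auto simp: polar_point_in_disc_iff)

section \<open>From the Poincare to the Beltrami-Klein model\<close>

lemma tanh_double_real: "tanh (2 * x :: real) = 2 * tanh x / (1 + (tanh x)\<^sup>2)"
  using tanh_add[of x x] by (simp add: power2_eq_square)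

lemma tanh_half_squared_real: "(tanh (x / 2 :: real))\<^sup>2 = (cosh x - 1) / (cosh x + 1)"
proof -
  have "cosh x - 1 = 2 * ((cosh (x / 2))\<^sup>2 - 1)" "cosh x + 1 = 2 * (cosh (x / 2))\<^sup>2"
    using cosh_double_cosh[of "x / 2"] by simp_all
  then show ?thesis
    by (simp only: tanh_def power_divide sinh_square_eq mult_divide_mult_cancel_left_if) simp
qed

text \<open>Monotonicity of \<open>x / (1 + x\<^sup>2)\<close>, cleared of denominators.\<close>

lemma div_one_plus_square_mono:
  fixes x y :: real
  assumes "0 \<le> x" "x \<le> y" "y \<le> 1"
  shows "x * (1 + y\<^sup>2) \<le> y * (1 + x\<^sup>2)"
proof -
  have "x * y \<le> 1" using assms by (simp add: mult_le_one)
  then have "0 \<le> (y - x) * (1 - x * y)" using assms by simp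
  then show ?thesis by (simp add: power2_eq_square algebra_simps)
qed

definition klein :: "complex \<Rightarrow> complex" where
  "klein z = (2 / (1 + (norm z)\<^sup>2)) *\<^sub>R z"

lemma norm_klein: "norm (klein z) = 2 * norm z / (1 + (norm z)\<^sup>2)"
  by (simp add: klein_def add_nonneg_nonneg)

lemma klein_polar_point: "klein (polar_point r \<theta>) = polar_point (2 * r) \<theta>"
proof -
  have "norm (polar_point r \<theta>) = \<bar>tanh r\<bar>" by (simp add: polar_point_def)
  then have "klein (polar_point r \<theta>) = (2 / (1 + (tanh r)\<^sup>2)) *\<^sub>R polar_point r \<theta>"
    by (simp only: klein_def power2_abs)
  then show ?thesis
    by (simp add: polar_point_def tanh_double_real rcis_def scaleR_conv_of_real)
qed

section \<open>The base figure and the tile\<close>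

text \<open>The angle condition says that a triangle with angles \<open>pi / p\<close>,
  \<open>pi / q\<close> and \<open>pi / 2\<close> is hyperbolic.\<close>

locale mosaic =
  fixes p q :: nat
  assumes p_ge: "3 \<le> p" and q_pos: "0 < q" and angle_sum: "pi / p + pi / q < pi / 2"
begin

text \<open>\<open>\<alpha>\<close> and \<open>\<gamma>\<close> are the acute angles of the right
  triangle formed by the centre of a tile, a vertex and the midpoint of an adjacent side.\<close>

definition \<alpha> :: real where "\<alpha> = pi / p"
definition \<gamma> :: real where "\<gamma> = pi / q"
definition b :: real where "b = base_circumradius p q"
text \<open>The distance from the origin to the centres of the side circles.\<close>

definition d :: real where "d = (1 + b\<^sup>2) / (2 * b * cos \<alpha>)"

section \<open>Trigonometry of circumradius, inradius and side circles\<close>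

lemma angles: "0 < \<alpha>" "0 < \<gamma>" "\<alpha> + \<gamma> < pi / 2"
  using p_ge q_pos angle_sum by (simp_all add: \<alpha>_def \<gamma>_def)

lemma trig_pos: "sin \<alpha> > 0" "cos \<alpha> > 0" "sin \<gamma> > 0" "cos \<gamma> > 0" "cos (\<alpha> + \<gamma>) > 0"
  using angles by (auto intro!: sin_gt_zero cos_gt_zero)

text \<open>Ensures that the \<open>arcosh\<close> argument of the inradius exceeds 1 and that the
  side circles are centred outside the unit disc.\<close>

lemma sin_less_cos: "sin \<alpha> < cos \<gamma>"
proof -
  have "cos (pi / 2 - \<alpha>) < cos \<gamma>" using angles by (intro cos_monotone_0_pi) auto
  then show ?thesis by (simp add: cos_diff)
qed

lemma tan_product: "0 < tan \<alpha> * tan \<gamma>" "tan \<alpha> * tan \<gamma> < 1"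
  using trig_pos by (simp_all add: tan_def cos_add)

text \<open>With \<open>t = tan \<alpha> * tan \<gamma>\<close> the hyperbolic circumradius has
  \<open>cosh\<close> equal to \<open>1 / t\<close>; the half-argument formula for
  \<open>tanh\<close> then yields the quotient under the root in
  \<open>base_circumradius\<close>.\<close>

lemma circumradius:
  shows "0 \<le> hyp_circumradius p q" and "b = tanh (hyp_circumradius p q / 2)"
proof -
  define t where "t = tan \<alpha> * tan \<gamma>"
  have t: "0 < t" "t < 1" using tan_product by (simp_all add: t_def)
  have R: "hyp_circumradius p q = arcosh (1 / t)"
    by (simp add: hyp_circumradius_def t_def \<alpha>_def \<gamma>_def cot_def tan_def)
  show nonneg: "0 \<le> hyp_circumradius p q" using t by (simp add: R)
  have "(tanh (hyp_circumradius p q / 2))\<^sup>2 = (1 / t - 1) / (1 / t + 1)"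
    using t by (simp add: tanh_half_squared_real R)
  also have "1 / t - 1 = (1 - t) / t" using t by (simp add: diff_divide_distrib)
  also have "1 / t + 1 = (1 + t) / t" using t by (simp add: add_divide_distrib)
  also have "(1 - t) / t / ((1 + t) / t) = (1 - t) / (1 + t)" using t by simp
  finally have "tanh (hyp_circumradius p q / 2) = sqrt ((1 - t) / (1 + t))"
    using nonneg by (metis tanh_real_nonneg_iff real_sqrt_unique divide_nonneg_nonneg zero_le_numeral)
  then show "b = tanh (hyp_circumradius p q / 2)"
    by (simp add: b_def base_circumradius_def t_def \<alpha>_def \<gamma>_def)
qed

lemma b_squared: "b\<^sup>2 = (1 - tan \<alpha> * tan \<gamma>) / (1 + tan \<alpha> * tan \<gamma>)"
  using tan_product by (simp add: b_def base_circumradius_def \<alpha>_def \<gamma>_def)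

lemma b_bounds: "0 < b" "b < 1"
proof -
  show "0 < b" using tan_product by (simp add: b_def base_circumradius_def \<alpha>_def \<gamma>_def)
  show "b < 1" by (simp add: circumradius(2) tanh_real_lt_1)
qed

text \<open>The closed form in the two angles from which both the radius of the side circles and the
  inradius of the tile are read off.\<close>

lemma d_squared: "d\<^sup>2 = (cos \<gamma>)\<^sup>2 / ((cos \<gamma>)\<^sup>2 - (sin \<alpha>)\<^sup>2)"
proof -
  define t where "t = tan \<alpha> * tan \<gamma>"
  have t: "0 < t" "t < 1" using tan_product by (simp_all add: t_def)
  have b2: "b\<^sup>2 = (1 - t) / (1 + t)" by (simp add: b_squared t_def)
  have b2': "1 + b\<^sup>2 = 2 / (1 + t)" using t by (simp add: b2 field_simps)
  have "d\<^sup>2 = (1 + b\<^sup>2)\<^sup>2 / (4 * b\<^sup>2 * (cos \<alpha>)\<^sup>2)"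
    by (simp add: d_def power_divide power_mult_distrib)
  also have "\<dots> = (2 / (1 + t))\<^sup>2 / (4 * ((1 - t) / (1 + t)) * (cos \<alpha>)\<^sup>2)"
    unfolding b2' unfolding b2 ..
  also have "\<dots> = 1 / ((1 - t\<^sup>2) * (cos \<alpha>)\<^sup>2)"
  proof -
    have "(2 / y)\<^sup>2 / (4 * (x / y) * (cos \<alpha>)\<^sup>2) = 1 / (x * y * (cos \<alpha>)\<^sup>2)"
      if "x > 0" "y > 0" for x y :: real
      using that trig_pos by (simp add: divide_simps power2_eq_square)
    from this[of "1 - t" "1 + t"] show ?thesis
      using t by (simp add: power2_eq_square algebra_simps)
  qed
  also have "(1 - t\<^sup>2) * (cos \<alpha>)\<^sup>2
      = ((cos \<alpha>)\<^sup>2 * (cos \<gamma>)\<^sup>2 - (sin \<alpha>)\<^sup>2 * (sin \<gamma>)\<^sup>2) / (cos \<gamma>)\<^sup>2"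
    using trig_pos by (simp add: t_def tan_def power_divide power_mult_distrib field_simps)
  also have "(cos \<alpha>)\<^sup>2 * (cos \<gamma>)\<^sup>2 - (sin \<alpha>)\<^sup>2 * (sin \<gamma>)\<^sup>2
      = (cos \<gamma>)\<^sup>2 - (sin \<alpha>)\<^sup>2"
    unfolding cos_squared_eq[of \<alpha>] sin_squared_eq[of \<gamma>] by (simp add: algebra_simps)
  finally show ?thesis by simp
qed

lemma cos_sin_diff_pos: "(cos \<gamma>)\<^sup>2 - (sin \<alpha>)\<^sup>2 > 0"
  using sin_less_cos trig_pos by (simp add: power_strict_mono)

lemma d_pos: "d > 0"
  using b_bounds trig_pos by (simp add: d_def add_pos_pos)

lemma d_gt_1: "d > 1"
proof -
  have "1\<^sup>2 < d\<^sup>2" using cos_sin_diff_pos trig_pos by (simp add: d_squared)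
  then show ?thesis using d_pos by (metis less_eq_real_def power2_less_imp_less)
qed

text \<open>The circle about a point at distance \<open>d\<close> is orthogonal to the unit circle.\<close>

lemma side_curvature: "side_curvature p q > 0" "(1 / side_curvature p q)\<^sup>2 = d\<^sup>2 - 1"
proof -
  define C2 where "C2 = ((cos \<gamma>)\<^sup>2 - (sin \<alpha>)\<^sup>2) / (sin \<alpha>)\<^sup>2"
  have pos: "C2 > 0" using cos_sin_diff_pos trig_pos by (simp add: C2_def)
  have s: "sin (\<alpha> + \<gamma>) > 0" using angles by (intro sin_gt_zero) auto
  have "sin (2 * \<alpha>) + sin (2 * \<gamma>) = 2 * sin (\<alpha> + \<gamma>) * cos (\<alpha> - \<gamma>)"
    using sin_plus_sin[of "2 * \<alpha>" "2 * \<gamma>"] by (simp add: add_divide_distrib diff_divide_distrib)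
  moreover have "1 - cos (2 * \<alpha>) = 2 * (sin \<alpha>)\<^sup>2" by (simp add: cos_double_sin)
  moreover have "cos (\<alpha> + \<gamma>) * cos (\<alpha> - \<gamma>) = (cos \<gamma>)\<^sup>2 - (sin \<alpha>)\<^sup>2"
  proof -
    have "cos (\<alpha> + \<gamma>) * cos (\<alpha> - \<gamma>) = (cos \<alpha>)\<^sup>2 * (cos \<gamma>)\<^sup>2 - (sin \<alpha>)\<^sup>2 * (sin \<gamma>)\<^sup>2"
      by (simp add: cos_add cos_diff power2_eq_square algebra_simps)
    also have "\<dots> = (cos \<gamma>)\<^sup>2 - (sin \<alpha>)\<^sup>2"
      unfolding cos_squared_eq[of \<alpha>] sin_squared_eq[of \<gamma>] by (simp add: algebra_simps)
    finally show ?thesis .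
  qed
  moreover have "side_curvature p q = sqrt (cos (\<alpha> + \<gamma>) * (sin (2 * \<alpha>) + sin (2 * \<gamma>))
      / (sin (\<alpha> + \<gamma>) * (1 - cos (2 * \<alpha>))))"
    by (simp add: side_curvature_def \<alpha>_def \<gamma>_def)
  ultimately have C: "side_curvature p q = sqrt C2" using s by (simp add: C2_def mult_ac)
  show "side_curvature p q > 0" using C pos by simp
  have "(1 / side_curvature p q)\<^sup>2 = 1 / C2" using C pos by (simp add: power_divide)
  then show "(1 / side_curvature p q)\<^sup>2 = d\<^sup>2 - 1"
    using cos_sin_diff_pos diff_divide_distrib[of "(cos \<gamma>)\<^sup>2" "(cos \<gamma>)\<^sup>2 - (sin \<alpha>)\<^sup>2"]
    by (simp add: d_squared C2_def)
qed

text \<open>The equation of the side circle at a vertex, whose component along the edge normal is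
  \<open>b * cos \<alpha>\<close>.\<close>

lemma d_b: "2 * d * (b * cos \<alpha>) = 1 + b\<^sup>2"
  using b_bounds trig_pos by (simp add: d_def)

text \<open>The left side is the Euclidean distance from the origin to the edges of the tile in the
  Klein model.\<close>

lemma tanh_circumradius: "tanh (hyp_circumradius p q) * cos \<alpha> = 1 / d"
proof -
  have "tanh (hyp_circumradius p q) = 2 * b / (1 + b\<^sup>2)"
    using tanh_double_real[of "hyp_circumradius p q / 2"] by (simp add: circumradius(2))
  then show ?thesis using b_bounds trig_pos by (simp add: d_def)
qed

text \<open>Here \<open>cosh\<close> of the inradius is \<open>cos \<gamma> / sin \<alpha>\<close>,
  so \<open>1 - 1 / cosh^2\<close> is the reciprocal of \<open>d_squared\<close>.\<close>

lemma inradius: "0 < hyp_inradius p q" "tanh (hyp_inradius p q) = 1 / d"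
proof -
  have ge: "cos \<gamma> / sin \<alpha> > 1" using sin_less_cos trig_pos by simp
  have r: "hyp_inradius p q = arcosh (cos \<gamma> / sin \<alpha>)"
    by (simp add: hyp_inradius_def \<alpha>_def \<gamma>_def)
  show pos: "0 < hyp_inradius p q" using ge sin_less_cos trig_pos by (simp add: r)
  have "(tanh (hyp_inradius p q))\<^sup>2 = 1 - 1 / (cosh (hyp_inradius p q))\<^sup>2"
    by (simp add: tanh_def power_divide sinh_square_eq diff_divide_distrib)
  also have "\<dots> = 1 - (sin \<alpha>)\<^sup>2 / (cos \<gamma>)\<^sup>2" using ge by (simp add: r power_divide)
  also have "\<dots> = 1 / d\<^sup>2" using trig_pos by (simp add: d_squared diff_divide_distrib)
  finally have "(tanh (hyp_inradius p q))\<^sup>2 = (1 / d)\<^sup>2" by (simp add: power_divide)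
  then show "tanh (hyp_inradius p q) = 1 / d"
    using pos d_pos by (simp add: power2_eq_iff_nonneg)
qed

text \<open>The centre is \<open>d\<close> times the edge normal and the squared radius is
  \<open>d^2 - 1\<close>, so the constant term of the circle equation is 1. On this circle the
  half-plane condition cutting out the minor arc becomes a norm bound.\<close>

lemma side_curve_eq:
  "side_curve p q k = {z. 1 + (norm z)\<^sup>2 = 2 * d * (z \<bullet> edge_normal p k) \<and> norm z \<le> b}"
proof -
  define \<psi> u where "\<psi> = (2 * real k + 1) * pi / real p" and "u = edge_normal p k"
  have u: "norm u = 1" "u \<bullet> u = 1" "u = cis \<psi>"
    by (simp_all add: u_def \<psi>_def edge_normal_def norm_eq_1[symmetric])
  have v: "base_vertex p q k = rcis b (\<psi> - \<alpha>)" "base_vertex p q (k + 1) = rcis b (\<psi> + \<alpha>)"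
    unfolding base_vertex_def adjacent_vertices(1)[of k p] adjacent_vertices(2)[of k p]
    by (simp_all add: b_def \<psi>_def \<alpha>_def)
  have m: "side_midpoint p q k = (b * cos \<alpha>) *\<^sub>R u"
    unfolding side_midpoint_def v midpoint_def u
    by (simp add: complex_eq_iff cos_add cos_diff sin_add sin_diff algebra_simps)
  have "rcis b (\<psi> - \<alpha>) - rcis b (\<psi> + \<alpha>) = (- 2 * b * sin \<alpha>) *\<^sub>R (\<i> * u)"
    unfolding u by (simp add: complex_eq_iff cos_add cos_diff sin_add sin_diff algebra_simps)
  then have h: "dist (base_vertex p q k) (base_vertex p q (k + 1)) / 2 = b * sin \<alpha>"
    unfolding v dist_norm using b_bounds trig_pos u by (simp add: norm_mult)
  have pos: "b * cos \<alpha> > 0" using b_bounds trig_pos by simp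
  have "b * cos \<alpha> \<le> 1" using b_bounds trig_pos by (intro mult_le_one) auto
  then have ge: "d - b * cos \<alpha> \<ge> 0" using d_gt_1 by simp
  \<comment> \<open>Pythagoras with the radius and half the chord: the square root in
    \<open>side_centre\<close> is the distance from the chord to the centre.\<close>
  have "(1 / side_curvature p q)\<^sup>2 - (b * sin \<alpha>)\<^sup>2 = d\<^sup>2 - 1 - b\<^sup>2 * (1 - (cos \<alpha>)\<^sup>2)"
    by (simp add: side_curvature power_mult_distrib sin_squared_eq)
  also have "\<dots> = d\<^sup>2 - 2 * d * (b * cos \<alpha>) + (b * cos \<alpha>)\<^sup>2"
    unfolding d_b by (simp add: power_mult_distrib algebra_simps)
  also have "\<dots> = (d - b * cos \<alpha>)\<^sup>2" by (simp add: power2_eq_square algebra_simps)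
  finally have sq: "sqrt ((1 / side_curvature p q)\<^sup>2 - (b * sin \<alpha>)\<^sup>2) = d - b * cos \<alpha>"
    using ge by simp
  have "sgn u = u" using u(1) by (simp add: sgn_div_norm)
  then have "sgn (side_midpoint p q k) = u"
    by (simp only: m sgn_scaleR sgn_pos[OF pos] scaleR_one)
  then have c: "side_centre p q k = d *\<^sub>R u"
    unfolding side_centre_def h sq unfolding m by (simp add: scaleR_diff_left)
  have circle: "dist z (side_centre p q k) = 1 / side_curvature p q \<longleftrightarrow>
      1 + (norm z)\<^sup>2 = 2 * d * (z \<bullet> u)" for z
  proof -
    have "dist z (side_centre p q k) = 1 / side_curvature p q \<longleftrightarrow>
        (dist z (side_centre p q k))\<^sup>2 = (1 / side_curvature p q)\<^sup>2"
      using side_curvature(1) by (subst power2_eq_iff_nonneg) auto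
    also have "(dist z (side_centre p q k))\<^sup>2 = (norm z)\<^sup>2 - 2 * d * (z \<bullet> u) + d\<^sup>2"
      unfolding c dist_norm power2_norm_eq_inner
      using u by (simp add: inner_diff inner_commute power2_eq_square algebra_simps)
    finally show ?thesis unfolding side_curvature by auto
  qed
  have "(z - side_midpoint p q k) \<bullet> side_midpoint p q k = b * cos \<alpha> * (z \<bullet> u - b * cos \<alpha>)" for z
    unfolding m using u by (simp add: inner_diff algebra_simps)
  then have half: "(z - side_midpoint p q k) \<bullet> side_midpoint p q k \<le> 0 \<longleftrightarrow> z \<bullet> u \<le> b * cos \<alpha>" for z
    using b_bounds trig_pos by (simp add: mult_le_0_iff)
  \<comment> \<open>On the circle \<open>z \<bullet> u\<close> increases with the norm and equals
    \<open>b * cos \<alpha>\<close> at norm \<open>b\<close>.\<close>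
  have "z \<bullet> u \<le> b * cos \<alpha> \<longleftrightarrow> norm z \<le> b" if "1 + (norm z)\<^sup>2 = 2 * d * (z \<bullet> u)" for z
  proof -
    have "z \<bullet> u \<le> b * cos \<alpha> \<longleftrightarrow> 2 * d * (z \<bullet> u) \<le> 2 * d * (b * cos \<alpha>)" using d_pos by simp
    also have "\<dots> \<longleftrightarrow> (norm z)\<^sup>2 \<le> b\<^sup>2" unfolding d_b that[symmetric] by simp
    also have "\<dots> \<longleftrightarrow> norm z \<le> b" using b_bounds by (simp add: power2_le_iff_abs_le)
    finally show ?thesis .
  qed
  then show ?thesis unfolding side_curve_def u_def[symmetric] using circle half by blast
qed

section \<open>Tile and base figure described by inequalities\<close>

lemma hyp_tile_eq: "hyp_tile p q = {w. \<forall>k<p. w \<bullet> edge_normal p k \<le> 1 / d}"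
proof -
  have "tanh (hyp_circumradius p q) > 0"
    using tanh_circumradius d_pos trig_pos by (metis zero_less_divide_1_iff zero_less_mult_pos2)
  then show ?thesis
    unfolding hyp_tile_def polar_point_def using regular_hull_eq[OF p_ge] tanh_circumradius
    by (simp add: \<alpha>_def)
qed

text \<open>Dividing the side circle condition by \<open>1 + (norm z)^2\<close> leaves a linear
  condition on \<open>klein z\<close>: the outside of the circle corresponds to the half-plane of a
  chord.\<close>

lemma klein_inner_le_iff: "klein z \<bullet> u \<le> 1 / d \<longleftrightarrow> 2 * d * (z \<bullet> u) \<le> 1 + (norm z)\<^sup>2"
proof -
  have "1 + (norm z)\<^sup>2 > 0" by (simp add: add_pos_nonneg)
  then show ?thesis using d_pos by (simp add: klein_def field_simps)
qed

lemma klein_in_hyp_tile_iff: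
  "klein z \<in> hyp_tile p q \<longleftrightarrow> (\<forall>k<p. 2 * d * (z \<bullet> edge_normal p k) \<le> 1 + (norm z)\<^sup>2)"
  by (simp add: hyp_tile_eq klein_inner_le_iff)

text \<open>The image of a side curve lies on an edge line within the circumradius, hence on an
  edge. A side therefore satisfies the conditions of all other sides without any comparison of
  pairs.\<close>

lemma side_curve_imp_klein_in_tile:
  assumes "z \<in> side_curve p q k"
  shows "klein z \<in> hyp_tile p q"
proof -
  define B where "B = tanh (hyp_circumradius p q)"
  have z: "1 + (norm z)\<^sup>2 = 2 * d * (z \<bullet> edge_normal p k)" "norm z \<le> b"
    using assms by (auto simp: side_curve_eq)
  have B: "B = 2 * b / (1 + b\<^sup>2)"
    using tanh_double_real[of "hyp_circumradius p q / 2"] by (simp add: B_def circumradius(2))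
  have pos: "1 + (norm z)\<^sup>2 > 0" "1 + b\<^sup>2 > 0" by (simp_all add: add_pos_nonneg)
  have "klein z \<bullet> edge_normal p k = B * cos (pi / p)"
  proof -
    have "klein z \<bullet> edge_normal p k = 2 * (z \<bullet> edge_normal p k) / (1 + (norm z)\<^sup>2)"
      by (simp add: klein_def)
    also have "\<dots> = 1 / d"
      using pos(1) unfolding z(1) by (cases "z \<bullet> edge_normal p k = 0") simp_all
    finally have "klein z \<bullet> edge_normal p k = 1 / d" .
    then show ?thesis using tanh_circumradius by (simp add: B_def \<alpha>_def)
  qed
  moreover have "norm (klein z) \<le> B"
    using div_one_plus_square_mono[of "norm z" b] z b_bounds pos
    by (simp add: norm_klein B field_simps)
  moreover have "B > 0" using b_bounds pos by (simp add: B)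
  ultimately have "klein z \<in> convex hull regular_vertices p B"
    using p_ge by (intro edge_in_regular_hull) auto
  then show ?thesis by (simp add: hyp_tile_def polar_point_def B_def)
qed

text \<open>For the nearest normal the condition is a quadratic inequality in \<open>norm z\<close>
  with roots \<open>b\<close> and \<open>1 / b\<close>; \<open>norm z < 1\<close> rules out the
  range beyond \<open>1 / b\<close>.\<close>

lemma norm_le_base_circumradius:
  assumes "norm z < 1" "\<And>k. k < p \<Longrightarrow> 2 * d * (z \<bullet> edge_normal p k) \<le> 1 + (norm z)\<^sup>2"
  shows "norm z \<le> b"
proof (rule ccontr)
  assume "\<not> norm z \<le> b"
  obtain k where k: "k < p" "norm z * cos \<alpha> \<le> z \<bullet> edge_normal p k"
    using exists_edge_normal_inner_ge[of p z] p_ge by (auto simp: \<alpha>_def)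
  have "2 * d * (norm z * cos \<alpha>) \<le> 1 + (norm z)\<^sup>2"
    using assms(2)[OF k(1)] k(2) d_pos by (smt (verit) mult_left_mono)
  then have "b * (2 * d * (norm z * cos \<alpha>)) \<le> b * (1 + (norm z)\<^sup>2)"
    using b_bounds by simp
  moreover have "b * (2 * d * (norm z * cos \<alpha>)) = norm z * (1 + b\<^sup>2)"
    using d_b by (simp add: algebra_simps)
  ultimately have "(norm z - b) * (1 - norm z * b) \<le> 0"
    by (simp add: power2_eq_square algebra_simps)
  moreover have "norm z * b < 1" using assms(1) b_bounds
    by (metis less_eq_real_def mult_strict_mono mult_1 norm_ge_zero zero_less_one)
  ultimately show False using \<open>\<not> norm z \<le> b\<close> by (simp add: mult_le_0_iff)
qed

text \<open>The strict inequalities define an open set \<open>I\<close>, starlike about the origin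
  and disjoint from the boundary, and the weak ones a closed set \<open>V\<close> with
  \<open>V - I\<close> inside the boundary. Hence \<open>I\<close> is the component of the
  origin.\<close>

lemma base_figure_eq:
  "base_figure p q =
    {z. norm z \<le> b \<and> (\<forall>k<p. 2 * d * (z \<bullet> edge_normal p k) \<le> 1 + (norm z)\<^sup>2)}"
proof -
  define I where "I = {z. norm z < b \<and> (\<forall>k<p. 2 * d * (z \<bullet> edge_normal p k) < 1 + (norm z)\<^sup>2)}"
  define V where "V = {z. norm z \<le> b \<and> (\<forall>k<p. 2 * d * (z \<bullet> edge_normal p k) \<le> 1 + (norm z)\<^sup>2)}"
  have boundary_V: "base_boundary p q \<subseteq> V"
    using side_curve_imp_klein_in_tile
    by (fastforce simp: base_boundary_def V_def klein_in_hyp_tile_iff side_curve_eq)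
  have V_I: "V - I \<subseteq> base_boundary p q"
  proof
    fix z assume z: "z \<in> V - I"
    \<comment> \<open>At norm \<open>b\<close> the nearest normal and \<open>d_b\<close> give the
      reversed side inequality, so such points of \<open>V\<close> also lie on a side.\<close>
    have "\<exists>k<p. 1 + (norm z)\<^sup>2 \<le> 2 * d * (z \<bullet> edge_normal p k)"
    proof (cases "norm z = b")
      case True
      obtain k where k: "k < p" "b * cos \<alpha> \<le> z \<bullet> edge_normal p k"
        using exists_edge_normal_inner_ge[of p z] p_ge True by (auto simp: \<alpha>_def)
      have "2 * d * (b * cos \<alpha>) \<le> 2 * d * (z \<bullet> edge_normal p k)" using k d_pos by simp
      then show ?thesis using k True d_b by auto
    next
      case False
      then show ?thesis using z by (auto simp: V_def I_def not_less)
    qed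
    then show "z \<in> base_boundary p q"
      using z by (force simp: V_def base_boundary_def side_curve_eq)
  qed
  have I_boundary: "I \<inter> base_boundary p q = {}"
    by (fastforce simp: I_def base_boundary_def side_curve_eq)
  have "0 \<in> I" using b_bounds by (simp add: I_def)
  have "starlike I"
    unfolding starlike_def
  proof (intro bexI[OF _ \<open>0 \<in> I\<close>] ballI subsetI)
    fix z y assume z: "z \<in> I" and "y \<in> closed_segment 0 z"
    then obtain t where t: "0 \<le> t" "t \<le> 1" and y: "y = t *\<^sub>R z"
      by (auto simp: closed_segment_def)
    have ny: "norm y = t * norm z" using t by (simp add: y)
    have "t * norm z \<le> norm z" using t by (simp add: mult_left_le_one_le)
    moreover have "2 * d * (y \<bullet> edge_normal p k) < 1 + (norm y)\<^sup>2" if "k < p" for k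
    proof (cases "t = 0")
      case False
      have "2 * d * (y \<bullet> edge_normal p k) = t * (2 * d * (z \<bullet> edge_normal p k))" by (simp add: y)
      also have "\<dots> < t * (1 + (norm z)\<^sup>2)" 
        using z that False t by (intro mult_strict_left_mono) (auto simp: I_def)
      also have "\<dots> \<le> 1 + (t * norm z)\<^sup>2"
      proof -
        have "(norm z)\<^sup>2 \<le> 1" using z b_bounds by (simp add: I_def power_le_one)
        then have "t * (norm z)\<^sup>2 \<le> 1" using t by (simp add: mult_le_one)
        \<comment> \<open>Expanded, this product is the difference of the two sides of the
          claim.\<close>
        then have "0 \<le> (1 - t) * (1 - t * (norm z)\<^sup>2)" using t by simp
        then show ?thesis by (simp add: power2_eq_square algebra_simps)
      qed
      finally show ?thesis by (simp add: ny)
    qed (simp add: y)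
    ultimately show "y \<in> I" using z by (simp add: I_def ny)
  qed
  then have "connected I" by (rule starlike_imp_connected)
  then have "I \<subseteq> connected_component_set (- base_boundary p q) 0"
    using \<open>0 \<in> I\<close> I_boundary by (intro connected_component_maximal) auto
  moreover have "connected_component_set (- base_boundary p q) 0 \<subseteq> I"
  proof -
    let ?S = "connected_component_set (- base_boundary p q) 0"
    have "open I"
    proof -
      have "I = {z. norm z < b} \<inter> (\<Inter>k\<in>{..<p}. {z. 2 * d * (z \<bullet> edge_normal p k) < 1 + (norm z)\<^sup>2})"
        by (auto simp: I_def)
      then show ?thesis
        by (auto intro!: open_Int open_INT open_Collect_less continuous_intros)
    qed
    moreover have "closed V"
    proof -
      have "V = {z. norm z \<le> b} \<inter> (\<Inter>k\<in>{..<p}. {z. 2 * d * (z \<bullet> edge_normal p k) \<le> 1 + (norm z)\<^sup>2})"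
        by (auto simp: V_def)
      then show ?thesis
        by (auto intro!: closed_Int closed_INT closed_Collect_le continuous_intros)
    qed
    moreover have "?S \<subseteq> I \<union> - V"
      using connected_component_subset[of "- base_boundary p q" 0] V_I by blast
    moreover have "I \<subseteq> V" by (auto simp: I_def V_def less_imp_le)
    moreover have "I \<inter> ?S \<noteq> {}" using \<open>0 \<in> I\<close> I_boundary by force
    \<comment> \<open>The component is covered by the disjoint open sets \<open>I\<close> and
      \<open>- V\<close> and meets \<open>I\<close>, so connectedness keeps it out of
      \<open>- V\<close>.\<close>
    ultimately have "- V \<inter> ?S = {}"
      using connectedD[OF connected_connected_component[of "- base_boundary p q" 0], of I "- V"]
      by (meson Diff_disjoint Int_assoc disjoint_iff ComplD open_Compl subsetD IntD1 IntD2)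
    then show ?thesis using \<open>?S \<subseteq> I \<union> - V\<close> by blast
  qed
  moreover have "I \<subseteq> V" by (auto simp: I_def V_def less_imp_le)
  ultimately have "base_figure p q = V"
    unfolding base_figure_def using boundary_V V_I by blast
  then show ?thesis by (simp add: V_def)
qed

lemma sl_area_base_figure: "sl_area (base_figure p q) = hyp_area (hyp_tile p q) / 4"
proof (rule sl_area_eq_hyp_area)
  show "closed (hyp_tile p q)"
    by (simp add: hyp_tile_def compact_imp_closed finite_imp_compact_convex_hull)
next
  fix r \<theta> :: real
  assume "r \<ge> 0"
  define z where "z = polar_point r \<theta>"
  have "norm z < 1" using \<open>r \<ge> 0\<close> tanh_real_lt_1[of r] by (simp add: z_def polar_point_def)
  \<comment> \<open>Inside the unit disc the bound \<open>norm z \<le> b\<close> follows from the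
    side conditions, so only these have to be carried over by \<open>klein\<close>.\<close>
  then have "z \<in> base_figure p q \<longleftrightarrow> klein z \<in> hyp_tile p q"
    using norm_le_base_circumradius[of z] by (auto simp: base_figure_eq klein_in_hyp_tile_iff)
  then show "polar_point r \<theta> \<in> base_figure p q \<longleftrightarrow> polar_point (2 * r) \<theta> \<in> hyp_tile p q"
    by (simp add: z_def klein_polar_point)
qed

section \<open>The inscribed circle\<close>

text \<open>For \<open>T = tanh r\<close> the double-argument formula gives
  \<open>2 * d * T = 1 + T^2\<close>, so the circle meets each side circle on its axis. Any contact
  attains equality in Cauchy-Schwarz, which makes it unique.\<close>

lemma inscribed_radius_half_inradius: "inscribed_radius p q (hyp_inradius p q / 2)"
proof -
  define r where "r = hyp_inradius p q / 2"
  define T where "T = tanh r"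
  have r: "r > 0" using inradius by (simp add: r_def)
  have T: "0 < T" "T < 1" using r by (simp_all add: T_def tanh_real_lt_1)
  have pos: "1 + T\<^sup>2 > 0" by (simp add: add_pos_nonneg)
  have "2 * T / (1 + T\<^sup>2) = 1 / d"
    using tanh_double_real[of r] inradius by (simp add: T_def r_def)
  then have dT: "2 * d * T = 1 + T\<^sup>2" using d_pos pos by (simp add: field_simps)
  \<comment> \<open>Needed for the contact point to lie on the minor arc and not merely on its
    circle.\<close>
  have Tb: "T \<le> b"
  proof -
    have "0 \<le> tanh (hyp_circumradius p q)" using circumradius by simp
    then have "tanh (hyp_inradius p q) \<le> tanh (hyp_circumradius p q)"
      unfolding inradius tanh_circumradius[symmetric] by (simp add: mult_left_le)
    then show ?thesis by (simp add: T_def r_def circumradius(2))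
  qed
  have "polar_disc r \<subseteq> base_figure p q"
  proof
    fix z assume "z \<in> polar_disc r"
    then have z: "norm z \<le> T" using r by (simp add: polar_disc_eq_cball T_def)
    have "2 * d * (z \<bullet> edge_normal p k) \<le> 1 + (norm z)\<^sup>2" for k
    proof -
      have "z \<bullet> edge_normal p k \<le> norm z" using norm_cauchy_schwarz[of z "edge_normal p k"] by simp
      then have "2 * d * (z \<bullet> edge_normal p k) \<le> 2 * d * norm z" using d_pos by simp
      \<comment> \<open>Multiplying by \<open>T\<close> lets \<open>2 * d * T\<close> be replaced by
        \<open>1 + T^2\<close>, which reduces the claim to the monotonicity of
        \<open>x / (1 + x^2)\<close>.\<close>
      moreover have "T * (2 * d * norm z) \<le> T * (1 + (norm z)\<^sup>2)"
        using div_one_plus_square_mono[of "norm z" T] z T unfolding dT[symmetric] by (simp add: mult_ac)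
      then have "2 * d * norm z \<le> 1 + (norm z)\<^sup>2" using T by simp
      ultimately show ?thesis by simp
    qed
    then show "z \<in> base_figure p q" using z Tb by (simp add: base_figure_eq)
  qed
  moreover have "\<exists>!z. z \<in> polar_circle r \<inter> side_curve p q k" for k
  proof (rule ex1I[of _ "T *\<^sub>R edge_normal p k"])
    show "T *\<^sub>R edge_normal p k \<in> polar_circle r \<inter> side_curve p q k"
      using r T Tb dT by (simp add: polar_circle_eq_sphere side_curve_eq T_def[symmetric])
  next
    fix z assume "z \<in> polar_circle r \<inter> side_curve p q k"
    then have z: "norm z = T" "2 * d * (z \<bullet> edge_normal p k) = 2 * d * T"
      using r unfolding dT by (auto simp: polar_circle_eq_sphere side_curve_eq T_def)
    then have "z \<bullet> edge_normal p k = norm z * norm (edge_normal p k)" using d_pos by simp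
    then show "z = T *\<^sub>R edge_normal p k" unfolding norm_cauchy_schwarz_eq by (simp add: z)
  qed
  ultimately show ?thesis using r by (simp add: inscribed_radius_def r_def)
qed

text \<open>Unique contact with a single side already fixes the radius: the contact lies on the axis
  of the side, and the circle equation there reads \<open>tanh (2 * r) = 1 / d\<close>.\<close>

lemma inscribed_radius_unique:
  assumes "inscribed_radius p q r"
  shows "r = hyp_inradius p q / 2"
proof -
  define T u where "T = tanh r" and "u = edge_normal p 0"
  have r: "r > 0" and ex1: "\<exists>!z. z \<in> polar_circle r \<inter> side_curve p q 0"
    using assms p_ge by (auto simp: inscribed_radius_def)
  have mem: "z \<in> polar_circle r \<inter> side_curve p q 0 \<longleftrightarrow>
      norm z = T \<and> 1 + (norm z)\<^sup>2 = 2 * d * (z \<bullet> u) \<and> norm z \<le> b" for z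
    using r by (auto simp: polar_circle_eq_sphere side_curve_eq T_def u_def)
  obtain z where z: "norm z = T" "1 + T\<^sup>2 = 2 * d * (z \<bullet> u)" "norm z \<le> b"
    using ex1 mem by auto
  \<comment> \<open>A single point of contact is fixed by the reflection in the axis of the side.\<close>
  have inner: "y \<bullet> u = Re (y * cnj u)" for y by (simp add: inner_complex_def)
  have uu: "u * cnj u = 1" by (simp add: u_def complex_norm_square[symmetric])
  define z' where "z' = u * u * cnj z"
  have "norm z' = norm z" by (simp add: z'_def norm_mult u_def)
  moreover have z'u: "z' * cnj u = cnj (z * cnj u)" using uu by (simp add: z'_def mult_ac)
  then have "z' \<bullet> u = z \<bullet> u" by (simp only: inner cnj.sel)
  ultimately have "z' = z" using ex1 mem z by metis
  then have "Im (z * cnj u) = 0" using z'u by (metis Reals_cnj_iff complex_is_Real_iff)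
  then have "norm (z * cnj u) = \<bar>z \<bullet> u\<bar>" unfolding inner by (simp add: cmod_eq_Re)
  then have "\<bar>z \<bullet> u\<bar> = T" using z by (simp add: norm_mult u_def)
  moreover have pos: "1 + T\<^sup>2 > 0" by (simp add: add_pos_nonneg)
  \<comment> \<open>The circle equation decides the sign: the contact lies on the same side of the
    origin as the centre of the side circle.\<close>
  then have "z \<bullet> u > 0" using z(2) d_pos by (metis mult_pos_pos zero_less_mult_pos zero_less_numeral)
  ultimately have dT: "1 + T\<^sup>2 = 2 * d * T" using z by simp
  have "tanh (2 * r) = 2 * T / (1 + T\<^sup>2)" by (simp add: tanh_double_real T_def)
  also have "\<dots> = 1 / d"
    using pos unfolding dT by (cases "T = 0") simp_all
  finally have "tanh (2 * r) = tanh (hyp_inradius p q)" by (simp add: inradius)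
  then show ?thesis by simp
qed

section \<open>The two densities\<close>

lemma r_opt_eq: "r_opt p q = hyp_inradius p q / 2"
  unfolding r_opt_def
  using inscribed_radius_half_inradius inscribed_radius_unique by (rule the_equality)

lemma R_opt_eq: "R_opt p q = hyp_circumradius p q / 2"
  unfolding R_opt_def b_def[symmetric] circumradius(2) by (rule artanh_tanh_real)

lemma densities:
  "packing_density_opt p q = hyp_area (polar_disc (hyp_inradius p q)) / hyp_area (hyp_tile p q)"
  "covering_density_opt p q = hyp_area (polar_disc (hyp_circumradius p q)) / hyp_area (hyp_tile p q)"
  using inradius circumradius
  by (simp_all add: packing_density_opt_def covering_density_opt_def r_opt_eq R_opt_eq
      sl_area_disc sl_area_base_figure)

end

text \<open>Clearing the positive denominator \<open>p - 2\<close> and dividing by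
  \<open>2 * p * q\<close> gives \<open>1 / p + 1 / q < 1 / 2\<close>.\<close>

lemma mosaicI:
  fixes p q :: nat
  assumes "p \<ge> 3" and q: "real q > 2 * real p / (real p - 2)"
  shows "mosaic p q"
proof
  show "3 \<le> p" by fact
  have p: "real p \<ge> 3" using assms by simp
  then have "0 < 2 * real p / (real p - 2)" by simp
  then have "0 < real q" using q by linarith
  then show "0 < q" by simp
  have "2 * real p < real q * (real p - 2)" using q p by (simp add: divide_less_eq)
  then have "1 / real p + 1 / real q < 1 / 2"
    using p \<open>0 < real q\<close> by (simp add: field_simps)
  then have "pi * (1 / real p + 1 / real q) < pi * (1 / 2)" by (simp only: mult_less_cancel_left_pos pi_gt_zero)
  then show "pi / real p + pi / real q < pi / 2" by (simp add: distrib_left)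
qed

theorem corollary5p1:
  fixes p q :: nat
  assumes "p \<ge> 3" and "real q > 2 * real p / (real p - 2)"
  shows "packing_density_opt p q =
           hyp_area (polar_disc (hyp_inradius p q)) / hyp_area (hyp_tile p q) \<and>
         covering_density_opt p q =
           hyp_area (polar_disc (hyp_circumradius p q)) / hyp_area (hyp_tile p q)"
  using mosaic.densities[OF mosaicI[OF assms]] by blast

end
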